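(* Let $(\lambda,\mu_1,\mu_2,F)$ and $(\lambda',\mu_1',\mu_2',F')$ be two elements of $[0,1/2)\times(\mathbb{R}^2\setminus\Delta)\times\mathcal{F}$ such that $$\lambda F(x-\mu_1)+(1-\lambda)F(x-\mu_2)=\lambda' F'(x-\mu_1')+(1-\lambda')F'(x-\mu_2')\qquad\text{for all }x\in\mathbb{R}.$$ Then $\lambda=\lambda'$, $\mu_2=\mu_2'$ and $F=F'$; and moreover $\mu_1=\mu_1'$ if $\lambda>0$.
   Context: $\Delta=\{(x,x):x\in\mathbb{R}\}$ is the diagonal of $\mathbb{R}^2$. $\mathcal{F}$ is the set of cumulative distribution functions (c.d.f.) of probability distributions on $\mathbb{R}$ that are symmetric about $0$ (i.e. invariant under $x\mapsto -x$). *)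

theory Defs
  imports "HOL-Probability.Probability"
begin

definition diagonal :: "(real \<times> real) set" where
  "diagonal = {(x, x) | x. True}"

definition symmetric_distribution :: "real measure \<Rightarrow> bool" where
  "symmetric_distribution M \<longleftrightarrow> real_distribution M \<and> distr M borel (\<lambda>x. - x) = M"

definition symmetric_cdfs :: "(real \<Rightarrow> real) set" where
  "symmetric_cdfs = {cdf M | M. symmetric_distribution M}"

end

theory Submission
  imports Defs
begin

text \<open>The characteristic function of a symmetric distribution is real and, near 0, nonzero.
  Writing \<open>A\<close> and \<open>B\<close> for the characteristic functions of the two mixing distributions, equality
  of the mixtures forces \<open>A * cnj B\<close> to be real near 0. Its imaginary part is a combination of
  four sines with frequencies \<open>mi - mj'\<close>; sines of distinct positive frequencies are linearly
  independent, so the terms of each frequency cancel among themselves, and since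
  \<open>l\<close> and \<open>l'\<close> are below 1/2 this identifies the parameters. Then \<open>A = B\<close> has no zeros and
  can be divided out.\<close>

section \<open>Two-point mixtures of translates\<close>

definition shift_mixture :: "real \<Rightarrow> real \<Rightarrow> real \<Rightarrow> real measure \<Rightarrow> real measure" where
  "shift_mixture p a b M =
    distr (measure_pmf (bernoulli_pmf p) \<Otimes>\<^sub>M M) borel (\<lambda>(c, x). x + (if c then a else b))"

lemma measurable_shift_map [measurable]:
  assumes "real_distribution M"
  shows "(\<lambda>(c, x). x + (if c then a else b)) \<in> borel_measurable (measure_pmf p \<Otimes>\<^sub>M M)"
proof -
  interpret real_distribution M by fact
  show ?thesis by measurable
qed

lemma real_distribution_shift_mixture:
  assumes "real_distribution M"
  shows "real_distribution (shift_mixture p a b M)"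
proof -
  interpret M: real_distribution M by fact
  interpret P: pair_prob_space "measure_pmf (bernoulli_pmf p)" M ..
  show ?thesis
    unfolding shift_mixture_def
    using P.real_distribution_distr measurable_shift_map[OF assms] by blast
qed

text \<open>Fubini over the coin and \<open>M\<close>. Taking \<open>g\<close> to be an indicator
  gives the cdf, taking it to be a complex exponential gives the characteristic function.\<close>

lemma integral_shift_mixture:
  fixes g :: "real \<Rightarrow> 'b::{banach, second_countable_topology}"
  assumes "real_distribution M" "0 \<le> p" "p \<le> 1"
    and g [measurable]: "g \<in> borel_measurable borel" and B: "\<And>x. norm (g x) \<le> B"
  shows "(\<integral>x. g x \<partial>shift_mixture p a b M) =
    p *\<^sub>R (\<integral>x. g (x + a) \<partial>M) + (1 - p) *\<^sub>R (\<integral>x. g (x + b) \<partial>M)"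
proof -
  interpret M: real_distribution M by fact
  interpret P: pair_prob_space "measure_pmf (bernoulli_pmf p)" M ..
  note [measurable] = measurable_shift_map[OF assms(1)]
  let ?h = "\<lambda>(c, x). x + (if c then a else b)"
  have "(\<integral>x. g x \<partial>shift_mixture p a b M) =
      (\<integral>z. g (?h z) \<partial>(measure_pmf (bernoulli_pmf p) \<Otimes>\<^sub>M M))"
    unfolding shift_mixture_def by (rule integral_distr) measurable
  also have "\<dots> = (\<integral>c. (\<integral>x. g (?h (c, x)) \<partial>M) \<partial>measure_pmf (bernoulli_pmf p))"
    by (rule P.integral_fst'[symmetric], rule P.integrable_const_bound[where B = B])
       (use B in \<open>auto\<close>)
  also have "\<dots> = p *\<^sub>R (\<integral>x. g (x + a) \<partial>M) + (1 - p) *\<^sub>R (\<integral>x. g (x + b) \<partial>M)"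
    using assms(2,3) by (subst integral_measure_pmf[of UNIV]) (auto simp: UNIV_bool)
  finally show ?thesis .
qed

lemma cdf_shift_mixture:
  assumes "real_distribution M" "0 \<le> p" "p \<le> 1"
  shows "cdf (shift_mixture p a b M) x = p * cdf M (x - a) + (1 - p) * cdf M (x - b)"
proof -
  interpret M: real_distribution M by fact
  interpret N: real_distribution "shift_mixture p a b M"
    using assms(1) by (rule real_distribution_shift_mixture)
  have ind: "(\<lambda>y. indicator {..x} (y + c) :: real) = indicator {..x - c}" for c
    by (auto simp: indicator_def fun_eq_iff)
  show ?thesis
    using integral_shift_mixture[OF assms, of "indicator {..x} :: real \<Rightarrow> real" 1 a b]
    by (simp add: ind cdf_def)
qed

lemma char_shift_mixture:
  assumes "real_distribution M" "0 \<le> p" "p \<le> 1"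
  shows "char (shift_mixture p a b M) t =
    (of_real p * cis (t * a) + of_real (1 - p) * cis (t * b)) * char M t"
proof -
  have shift: "(CLINT x|M. iexp (t * (x + c))) = cis (t * c) * char M t" for c
    unfolding char_def integral_mult_right_zero[symmetric]
    by (simp add: cis_conv_exp distrib_left exp_add mult.commute)
  have "char (shift_mixture p a b M) t = p *\<^sub>R (CLINT x|M. iexp (t * (x + a))) +
      (1 - p) *\<^sub>R (CLINT x|M. iexp (t * (x + b)))"
    unfolding char_def by (rule integral_shift_mixture[OF assms, where B = 1]) auto
  then show ?thesis
    unfolding shift by (simp add: scaleR_conv_of_real algebra_simps)
qed

text \<open>Reflecting a distribution conjugates its characteristic function, which invariance
  therefore makes self-conjugate.\<close>

lemma char_symmetric_real:
  assumes "symmetric_distribution M"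
  shows "Im (char M t) = 0"
proof -
  interpret M: real_distribution M
    using assms by (simp add: symmetric_distribution_def)
  have "char M t = char (distr M borel (\<lambda>x. - x)) t"
    using assms by (simp add: symmetric_distribution_def)
  also have "\<dots> = (CLINT x|M. cnj (iexp (t * x)))"
    unfolding char_def by (subst integral_distr) (auto simp: exp_cnj)
  also have "\<dots> = cnj (char M t)"
    unfolding char_def by (rule Bochner_Integration.integral_cnj)
  finally show ?thesis
    by (metis complex_In_mult_cnj_zero complex_cnj_cancel_iff complex_eq_iff cnj.simps(2) equal_neg_zero)
qed

section \<open>Independence of sines on a neighbourhood of 0\<close>

lemma sine_sum_second_derivative:
  fixes w f :: "'i \<Rightarrow> real"
  assumes "open S" and zero: "\<And>t. t \<in> S \<Longrightarrow> (\<Sum>i\<in>I. w i * sin (f i * t)) = 0" and "t \<in> S"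
  shows "(\<Sum>i\<in>I. w i * (f i)\<^sup>2 * sin (f i * t)) = 0"
proof -
  have cos0: "(\<Sum>i\<in>I. w i * f i * cos (f i * t)) = 0" if "t \<in> S" for t
  proof (rule DERIV_unique)
    show "((\<lambda>t. \<Sum>i\<in>I. w i * sin (f i * t)) has_real_derivative
        (\<Sum>i\<in>I. w i * f i * cos (f i * t))) (at t)"
      by (auto intro!: derivative_eq_intros sum.cong)
    show "((\<lambda>t. \<Sum>i\<in>I. w i * sin (f i * t)) has_real_derivative 0) (at t)"
      by (rule has_field_derivative_transform_within_open[of "\<lambda>_. 0" _ _ S])
         (use assms(1) zero that in auto)
  qed
  have "- (\<Sum>i\<in>I. w i * (f i)\<^sup>2 * sin (f i * t)) = 0"
  proof (rule DERIV_unique)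
    show "((\<lambda>t. \<Sum>i\<in>I. w i * f i * cos (f i * t)) has_real_derivative
        - (\<Sum>i\<in>I. w i * (f i)\<^sup>2 * sin (f i * t))) (at t)"
      by (auto intro!: derivative_eq_intros sum.cong simp: sum_negf[symmetric] power2_eq_square)
    show "((\<lambda>t. \<Sum>i\<in>I. w i * f i * cos (f i * t)) has_real_derivative 0) (at t)"
      by (rule has_field_derivative_transform_within_open[of "\<lambda>_. 0" _ _ S])
         (use assms cos0 in auto)
  qed
  then show ?thesis by simp
qed

text \<open>The operator \<open>D\<^sup>2 + (f j)\<^sup>2\<close> annihilates the \<open>j\<close>-th term and multiplies the others by
  \<open>(f j)\<^sup>2 - (f i)\<^sup>2\<close>, so all frequencies of modulus other than \<open>r\<close> can be removed one at a time.\<close>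
lemma sine_sum_coefficient:
  fixes w f :: "'i \<Rightarrow> real"
  assumes "finite I" "r > 0" "e > 0"
    and "\<And>t. \<bar>t\<bar> < e \<Longrightarrow> (\<Sum>i\<in>I. w i * sin (f i * t)) = 0"
  shows "(\<Sum>i\<in>I. w i * (of_bool (f i = r) - of_bool (f i = - r))) = 0"
  using assms(1,4)
proof (induction "card {i\<in>I. \<bar>f i\<bar> \<noteq> r}" arbitrary: I w)
  case 0
  then have *: "f i = r \<or> f i = - r" if "i \<in> I" for i
    using that by fastforce
  \<comment> \<open>The bound \<open>e / 2\<close> keeps \<open>t\<close> where the sum vanishes;
    \<open>pi / (2 * r)\<close> makes \<open>sin (r * t)\<close> positive.\<close>
  define t where "t = min (e / 2) (pi / (2 * r))"
  have t: "0 < t" "t < e"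
    using assms(2,3) by (auto simp: t_def min_less_iff_disj)
  have "t * r \<le> pi / (2 * r) * r"
    unfolding t_def using assms(2) by (intro mult_right_mono) auto
  also have "\<dots> < pi"
    using assms(2) by simp
  finally have "t * r < pi" .
  have sin_eq: "w i * sin (f i * t) = w i * (of_bool (f i = r) - of_bool (f i = - r)) * sin (r * t)"
    if "i \<in> I" for i
    using *[OF that] assms(2) by auto
  then have "(\<Sum>i\<in>I. w i * (of_bool (f i = r) - of_bool (f i = - r))) * sin (r * t) = 0"
    using "0.prems"(2)[of t] t by (simp add: sum_distrib_right sum.cong[OF refl sin_eq, symmetric])
  moreover have "sin (r * t) > 0"
    using t assms(2) \<open>t * r < pi\<close> by (intro sin_gt_zero) (auto simp: mult.commute)
  ultimately show ?case by simp
next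
  case (Suc n)
  from Suc.hyps(2) obtain j where j: "j \<in> I" "\<bar>f j\<bar> \<noteq> r"
    by (metis (mono_tags, lifting) card.empty empty_Collect_eq nat.distinct(1))
  let ?J = "I - {j}"
  define v where "v i = w i * ((f j)\<^sup>2 - (f i)\<^sup>2)" for i
  \<comment> \<open>Since \<open>v j = 0\<close>, index \<open>j\<close> drops out. Leaving
    \<open>h\<close> free serves both the sines and, after the induction step, the signed
    indicators.\<close>
  have split: "(\<Sum>i\<in>I. v i * h i) = (\<Sum>i\<in>?J. v i * h i)" for h :: "'i \<Rightarrow> real"
    using Suc.prems(1) j by (simp add: sum.remove v_def)
  have "{i\<in>?J. \<bar>f i\<bar> \<noteq> r} = {i\<in>I. \<bar>f i\<bar> \<noteq> r} - {j}" by auto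
  then have "n = card {i\<in>?J. \<bar>f i\<bar> \<noteq> r}"
    using Suc.hyps(2) j Suc.prems(1) by simp
  moreover have "(\<Sum>i\<in>?J. v i * sin (f i * t)) = 0" if "\<bar>t\<bar> < e" for t
  proof -
    have "(\<Sum>i\<in>I. w i * (f i)\<^sup>2 * sin (f i * t)) = 0"
      by (rule sine_sum_second_derivative[of "{-e<..<e}"]) (use Suc.prems(2) that in auto)
    moreover have "(\<Sum>i\<in>I. v i * sin (f i * t)) =
        (f j)\<^sup>2 * (\<Sum>i\<in>I. w i * sin (f i * t)) - (\<Sum>i\<in>I. w i * (f i)\<^sup>2 * sin (f i * t))"
      by (simp add: v_def sum_distrib_left sum_subtractf[symmetric] algebra_simps)
    ultimately show ?thesis
      using Suc.prems(2)[OF that] split by simp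
  qed
  ultimately have "(\<Sum>i\<in>?J. v i * (of_bool (f i = r) - of_bool (f i = - r))) = 0"
    using Suc.hyps(1)[of ?J v] Suc.prems(1) by simp
  then have "(\<Sum>i\<in>I. v i * (of_bool (f i = r) - of_bool (f i = - r))) = 0"
    by (simp only: split)
  \<comment> \<open>The bracket vanishes unless \<open>f i\<close> is \<open>r\<close> or
    \<open>- r\<close>, so the factor inside \<open>v i\<close> may be replaced by a constant,
    nonzero by the choice of \<open>j\<close>.\<close>
  moreover have "v i * (of_bool (f i = r) - of_bool (f i = - r)) =
      ((f j)\<^sup>2 - r\<^sup>2) * (w i * (of_bool (f i = r) - of_bool (f i = - r)))" for i
    by (auto simp: v_def)
  ultimately have "((f j)\<^sup>2 - r\<^sup>2) * (\<Sum>i\<in>I. w i * (of_bool (f i = r) - of_bool (f i = - r))) = 0"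
    by (simp add: sum_distrib_left)
  moreover have "(f j)\<^sup>2 \<noteq> r\<^sup>2"
    using j(2) assms(2) by (metis abs_of_pos power2_eq_iff abs_minus_cancel)
  ultimately show ?case by simp
qed

section \<open>Recovering the parameters from the sine coefficients\<close>

text \<open>Because \<open>(1 - l) * (1 - l')\<close> exceeds each of the other three weights, a nonzero frequency
  \<open>d = m2 - m2'\<close> could only be cancelled by \<open>m1 - m2' = m2 - m1' = - d\<close>. Then \<open>m1 - m1' = - 3 * d\<close>
  is left without a partner, so \<open>l * l' = 0\<close> and the cancelling weights are too small.\<close>
lemma sine_weights_determine_parameters:
  fixes l l' m1 m2 m1' m2' :: real
  defines "s \<equiv> \<lambda>r x. (of_bool (x = r) - of_bool (x = - r) :: real)"
  assumes l: "0 \<le> l" "l < 1/2" and l': "0 \<le> l'" "l' < 1/2"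
    and m: "m1 \<noteq> m2" and m': "m1' \<noteq> m2'"
    and coeff: "\<And>r. r > 0 \<Longrightarrow> l * l' * s r (m1 - m1') + l * (1 - l') * s r (m1 - m2') +
      (1 - l) * l' * s r (m2 - m1') + (1 - l) * (1 - l') * s r (m2 - m2') = 0"
  shows "l = l' \<and> m2 = m2' \<and> (l > 0 \<longrightarrow> m1 = m1')"
proof -
  define a b c d where "a = m1 - m1'" and "b = m1 - m2'" and "c = m2 - m1'" and "d = m2 - m2'"
  define p q u v where "p = l * l'" and "q = l * (1 - l')" and "u = (1 - l) * l'"
    and "v = (1 - l) * (1 - l')"
  have freq: "a + d = b + c" "a \<noteq> b" "a \<noteq> c" "d \<noteq> b" "d \<noteq> c"
    using m m' by (auto simp: a_def b_def c_def d_def)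
  have nonneg: "0 \<le> p" "0 \<le> q" "0 \<le> u"
    using l l' by (auto simp: p_def q_def u_def)
  have "q < v" "u < v"
    unfolding q_def u_def v_def using l l'
    by (auto intro!: mult_strict_right_mono mult_strict_left_mono)
  moreover have "p \<le> q"
    unfolding p_def q_def using l l' by (auto intro!: mult_left_mono)
  ultimately have v: "q < v" "u < v" "p < v" by auto
  have p0: "q = 0 \<or> u = 0" if "p = 0"
    using that by (auto simp: p_def q_def u_def)
  \<comment> \<open>\<open>s\<close> is odd in \<open>r\<close>, so any nonzero frequency, of either
    sign, may be inserted below.\<close>
  have co: "p * s r a + q * s r b + u * s r c + v * s r d = 0" if "r \<noteq> 0" for r
  proof -
    have "p * s t a + q * s t b + u * s t c + v * s t d = 0" if "t > 0" for t
      using coeff[OF that] by (simp add: p_def q_def u_def v_def a_def b_def c_def d_def)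
    from this[of r] this[of "- r"] that show ?thesis
      by (cases "r > 0") (auto simp: s_def algebra_simps)
  qed
  have s_same: "s x x = 1" if "x \<noteq> 0" for x
    using that by (simp add: s_def)
  have s_nonneg: "s x y \<ge> 0" if "y \<noteq> - x" for x y
    using that by (simp add: s_def)
  have "d = 0"
  proof (rule ccontr)
    assume "d \<noteq> 0"
    show False
    proof (cases "b = - d \<and> c = - d")
      case True
      then have "a = - 3 * d" using freq by simp
      with True \<open>d \<noteq> 0\<close> have "p = 0"
        using co[of a] by (simp add: s_def)
      moreover have "q + u = v"
        using co[of d] True \<open>d \<noteq> 0\<close> \<open>p = 0\<close> by (simp add: s_def)
      ultimately show False using p0 v by auto
    next
      case False
      \<comment> \<open>At most one of \<open>a\<close>, \<open>b\<close>, \<open>c\<close> equals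
        \<open>- d\<close>: if \<open>a = - d\<close> then \<open>c = - b\<close>, and
        \<open>b = - d\<close> or \<open>c = - d\<close> would make the other equal
        \<open>d\<close>. One weight alone cannot offset \<open>v\<close>.\<close>
      then show False
        using co[of d] freq nonneg v \<open>d \<noteq> 0\<close>
        by (auto simp: s_def of_bool_def split: if_splits)
    qed
  qed
  then have a: "a = b + c" and nz: "b \<noteq> 0" "c \<noteq> 0"
    using freq by auto
  have co': "p * s r a + q * s r b + u * s r c = 0" if "r \<noteq> 0" for r
    using co[of r] that \<open>d = 0\<close> by (simp add: s_def)
  show ?thesis
  proof (cases "p = 0")
    case True
    \<comment> \<open>One of \<open>q\<close>, \<open>u\<close> is zero, and the other is then the
      only weight left and has nothing to cancel it.\<close>
    then have "q = 0" "u = 0"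
      using p0[OF True] co'[of b] co'[of c] nz s_same by auto
    then show ?thesis
      using \<open>d = 0\<close> l l' by (auto simp: q_def u_def d_def)
  next
    case False
    then have pos: "p > 0" "q > 0" "u > 0"
      using l l' nonneg by (auto simp: p_def q_def u_def)
    \<comment> \<open>Otherwise only \<open>a\<close> can cancel the terms at \<open>b\<close> and
      at \<open>c\<close>, so \<open>a = - b = - c\<close>; with \<open>a = b + c\<close> this
      forces \<open>b = 0\<close>.\<close>
    have "c = - b"
    proof (rule ccontr)
      assume "c \<noteq> - b"
      have "a = - b"
      proof (rule ccontr)
        assume "a \<noteq> - b"
        then have "p * s b a \<ge> 0" "u * s b c \<ge> 0"
          using s_nonneg \<open>c \<noteq> - b\<close> nz pos by simp_all
        then show False using co'[of b] nz s_same[of b] pos by simp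
      qed
      moreover have "a = - c"
      proof (rule ccontr)
        assume "a \<noteq> - c"
        then have "p * s c a \<ge> 0" "q * s c b \<ge> 0"
          using s_nonneg[of a c] s_nonneg[of b c] \<open>c \<noteq> - b\<close> pos by auto
        then show False using co'[of c] nz s_same[of c] pos by simp
      qed
      ultimately show False using a nz by simp
    qed
    then have "a = 0" using a by simp
    \<comment> \<open>Expanded, this equality says \<open>l = l'\<close>.\<close>
    moreover have "q = u"
      using co'[of b] \<open>c = - b\<close> \<open>a = 0\<close> nz by (simp add: s_def)
    ultimately show ?thesis
      using \<open>d = 0\<close> by (auto simp: q_def u_def a_def d_def algebra_simps)
  qed
qed

section \<open>Identifiability of the mixture\<close>

theorem theorem2p1:
  fixes l l' m1 m2 m1' m2' :: real and F F' :: "real \<Rightarrow> real"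
  assumes "(l, (m1, m2), F) \<in> {0..<1/2} \<times> (UNIV - diagonal) \<times> symmetric_cdfs"
    and "(l', (m1', m2'), F') \<in> {0..<1/2} \<times> (UNIV - diagonal) \<times> symmetric_cdfs"
    and "\<forall>x. l * F (x - m1) + (1 - l) * F (x - m2) = l' * F' (x - m1') + (1 - l') * F' (x - m2')"
  shows "l = l' \<and> m2 = m2' \<and> F = F' \<and> (l > 0 \<longrightarrow> m1 = m1')"
proof -
  from assms(1,2) obtain M M' where
    M: "symmetric_distribution M" "F = cdf M" and M': "symmetric_distribution M'" "F' = cdf M'"
    and l: "0 \<le> l" "l < 1/2" and l': "0 \<le> l'" "l' < 1/2"
    and m: "m1 \<noteq> m2" and m': "m1' \<noteq> m2'"
    by (auto simp: symmetric_cdfs_def diagonal_def)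
  interpret M: real_distribution M
    using M by (simp add: symmetric_distribution_def)
  interpret M': real_distribution M'
    using M' by (simp add: symmetric_distribution_def)
  define A where "A t = of_real l * cis (t * m1) + of_real (1 - l) * cis (t * m2)" for t
  define B where "B t = of_real l' * cis (t * m1') + of_real (1 - l') * cis (t * m2')" for t
  have "shift_mixture l m1 m2 M = shift_mixture l' m1' m2' M'"
    by (rule cdf_unique)
       (use assms(3) l l' M(2) M'(2) M.real_distribution_axioms M'.real_distribution_axioms
        in \<open>auto simp: cdf_shift_mixture real_distribution_shift_mixture\<close>)
  then have char_eq: "A t * char M t = B t * char M' t" for t
    using char_shift_mixture[OF M.real_distribution_axioms, of l m1 m2 t] l
      char_shift_mixture[OF M'.real_distribution_axioms, of l' m1' m2' t] l'
    by (simp add: A_def B_def)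
  obtain e where e: "e > 0" "\<And>t. \<bar>t\<bar> < e \<Longrightarrow> char M t \<noteq> 0"
    using continuous_at_avoid[OF M.isCont_char, of 0 0] M.char_zero by (auto simp: dist_real_def)
  \<comment> \<open>Multiplying \<open>char_eq\<close> by \<open>cnj (B t)\<close> makes its right
    side real; the real nonzero factor \<open>char M t\<close> can then be removed on the
    left.\<close>
  have im0: "Im (A t * cnj (B t)) = 0" if "\<bar>t\<bar> < e" for t
  proof -
    have real: "char M t = of_real (Re (char M t))" "char M' t = of_real (Re (char M' t))"
      using char_symmetric_real M(1) M'(1) by (auto simp: complex_eq_iff)
    have "Re (char M t) * Im (A t * cnj (B t)) =
        Im (A t * of_real (Re (char M t)) * cnj (B t))"
      by (simp add: algebra_simps)
    also have "\<dots> = Im (B t * of_real (Re (char M' t)) * cnj (B t))"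
      using char_eq[of t] real by simp
    also have "\<dots> = 0"
      by (simp add: algebra_simps)
    finally have "Re (char M t) * Im (A t * cnj (B t)) = 0" .
    with e(2)[OF that] real(1) show ?thesis by auto
  qed
  let ?w = "(!) [l * l', l * (1 - l'), (1 - l) * l', (1 - l) * (1 - l')]"
  let ?f = "(!) [m1 - m1', m1 - m2', m2 - m1', m2 - m2']"
  have "Im (A t * cnj (B t)) = (\<Sum>i<4. ?w i * sin (?f i * t))" for t
    by (simp add: A_def B_def eval_nat_numeral left_diff_distrib sin_diff algebra_simps)
  then have "(\<Sum>i<4. ?w i * (of_bool (?f i = r) - of_bool (?f i = - r))) = 0" if "r > 0" for r
    using sine_sum_coefficient[of "{..<4}" r e ?w ?f] that e(1) im0 by simp
  then have params: "l = l' \<and> m2 = m2' \<and> (l > 0 \<longrightarrow> m1 = m1')"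
    by (intro sine_weights_determine_parameters[OF l l' m m']) (simp add: eval_nat_numeral)
  \<comment> \<open>If \<open>l = 0\<close>, then \<open>m1\<close> and \<open>m1'\<close> may
    differ, but their terms have weight 0.\<close>
  have AB: "A t = B t" for t
    using params l(1) by (cases "l = 0") (auto simp: A_def B_def)
  \<comment> \<open>The two terms have moduli \<open>l\<close> and \<open>1 - l\<close>, which
    differ as \<open>l < 1/2\<close>. This holds for every \<open>t\<close>, so the division is not
    confined to a neighbourhood of 0.\<close>
  have "A t \<noteq> 0" for t
  proof
    assume "A t = 0"
    then have "cmod (of_real l * cis (t * m1)) = cmod (of_real (1 - l) * cis (t * m2))"
      unfolding A_def by (metis add_eq_0_iff norm_minus_cancel)
    with l show False by (simp add: norm_mult del: of_real_diff)
  qed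
  then have "char M = char M'"
    using char_eq AB by (metis ext mult_left_cancel)
  then have "M = M'"
    by (rule Levy_uniqueness[OF M.real_distribution_axioms M'.real_distribution_axioms])
  then show ?thesis using params M(2) M'(2) by simp
qed

end
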